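(* Let $\mathcal{X}$ be the solution set (a set of $m\times n$ binary matrices) of an integer linear program with cost $c$, and let $Q_1,\dots,Q_s\subset\mathcal{X}$ be such that for each $i\in\{1,\dots,s\}$ the sub-symmetry group $\mathcal{G}_{Q_i}$ is the sub-symmetric group with respect to $(R_i,C_i)$, where $R_i\subset\{1,\dots,m\}$ and $C_i\subset\{1,\dots,n\}$. Let $O^i_k$, $k\in\{1,\dots,o_i\}$, be the orbits of $\mathcal{G}_{Q_i}$ on $Q_i$, and for each orbit $O^i_k$ let its representative $X^i_k\in O^i_k$ be the element whose sub-matrix $X^i_k(R_i,C_i)$ has lexicographically non-increasing columns. Then the set of representatives $\{X^i_k : k\in\{1,\dots,o_i\},\ i\in\{1,\dots,s\}\}$ is orbit-compatible.
   Context: Lexicographic order: for $0/1$ column vectors $y,z$ of equal length, $y\succ z$ if at the first row where they differ $y$ has a $1$ and $z$ a $0$; columns are lexicographically non-increasing if each is equal to or lexicographically greater than the next. For $X\in\mathcal{X}$, $X(R,C)$ is the sub-matrix of $X$ on rows $R$ and columns $C$ (rows and columns in their natural order). Sub-symmetry groups: permutations of the index set $\{1,\dots,m\}\times\{1,\dots,n\}$ act on $m\times n$ matrices by permuting entries. For $Q\subset\mathcal{X}$, the sub-symmetry group $\mathcal{G}_Q$ is the set of all index permutations $\pi$ such that $\pi(X)\in Q$ and $c(\pi(X))=c(X)$ for every $X\in Q$ (the symmetry group of $\min\{c(x) : x\in Q\}$). $\mathcal{G}_Q$ is the sub-symmetric group with respect to $(R,C)$ if it is the set of all permutations of the columns of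 $X(R,C)$, i.e. of all index permutations that permute the columns of the sub-matrix on rows $R$ and columns $C$ and leave all entries outside $R\times C$ in place. Generalized orbits: for a matrix $X$, $\mathcal{G}(X)=\bigcup_{i : X\in Q_i}\mathcal{G}_{Q_i}$. Say $X'\,\mathcal{R}\,X$ if there exist $r\in\mathbb{N}$ and $\pi_1,\dots,\pi_r$ with $\pi_k\in\mathcal{G}(\pi_{k-1}\cdots\pi_1(X))$ for all $k\in\{1,\dots,r\}$ and $X'=\pi_r\cdots\pi_1(X)$. $\mathcal{R}$ is an equivalence relation on $\mathcal{X}$; its classes are the generalized orbits (with respect to $\{Q_1,\dots,Q_s\}$). Orbit-compatibility: let $\mathcal{O}=\{O^i_k\}$ be the family of all orbits of the groups $\mathcal{G}_{Q_i}$ on $Q_i$, $i=1,\dots,s$, and let each $\sigma\in\mathcal{O}$ have a chosen representative $r(\sigma)\in\sigma$. The set $\{r(\sigma):\sigma\in\mathcal{O}\}$ is orbit-compatible if for every generalized orbit of the form $\mathbb{O}=\bigcup_{i=1}^p\sigma_i$, where $\sigma_1,\dots,\sigma_p$ ($p\ge1$) are the members of $\mathcal{O}$ contained in $\mathbb{O}$, there exists $j\in\{1,\dots,p\}$ such that $r(\sigma_j)=r(\sigma_i)$ for all $i$ with $r(\sigma_j)\in\sigma_i$. *)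

theory Defs
  imports "Jordan_Normal_Form.DL_Submatrix" "HOL-Algebra.Group_Action"
    "HOL-Combinatorics.Permutations"
begin

text \<open>
  Matrices are those of \<open>Jordan_Normal_Form\<close>, so rows and columns are numbered from 0 and the
  index set is \<open>{..<m} \<times> {..<n}\<close>.
\<close>

definition binary_mats :: "nat \<Rightarrow> nat \<Rightarrow> int mat set" where
  "binary_mats m n = {X \<in> carrier_mat m n. elements_mat X \<subseteq> {0, 1}}"

definition linear_form :: "real mat \<Rightarrow> int mat \<Rightarrow> real" where
  "linear_form a X = (\<Sum>i<dim_row a. \<Sum>j<dim_col a. a $$ (i, j) * of_int (X $$ (i, j)))"

text \<open>
  A pair \<open>(a, b)\<close> in \<open>K\<close> is the linear constraint \<open>\<Sum>i j. a i j * X i j \<le> b\<close>.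
\<close>

definition ilp_solutions :: "nat \<Rightarrow> nat \<Rightarrow> (real mat \<times> real) set \<Rightarrow> int mat set" where
  "ilp_solutions m n K = {X \<in> binary_mats m n. \<forall>(a, b)\<in>K. linear_form a X \<le> b}"

definition index_perms :: "nat \<Rightarrow> nat \<Rightarrow> (nat \<times> nat \<Rightarrow> nat \<times> nat) set" where
  "index_perms m n = {\<pi>. \<pi> permutes ({..<m} \<times> {..<n})}"

text \<open>
  The entry of \<open>X\<close> at position \<open>p\<close> is moved to position \<open>\<pi> p\<close>. The inverse makes this a left action:
  acting with \<open>\<pi>\<^sub>1\<close> and then with \<open>\<pi>\<^sub>2\<close> is acting with \<open>\<pi>\<^sub>2 \<circ> \<pi>\<^sub>1\<close>.
\<close>

definition permute_entries :: "(nat \<times> nat \<Rightarrow> nat \<times> nat) \<Rightarrow> 'a mat \<Rightarrow> 'a mat" where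
  "permute_entries \<pi> X = mat (dim_row X) (dim_col X) (\<lambda>p. X $$ (inv_into UNIV \<pi> p))"

definition perm_monoid :: "('a \<Rightarrow> 'a) set \<Rightarrow> ('a \<Rightarrow> 'a) monoid" where
  "perm_monoid P = \<lparr>carrier = P, mult = (\<circ>), one = id\<rparr>"

definition sub_symmetry_group ::
  "nat \<Rightarrow> nat \<Rightarrow> real mat \<Rightarrow> int mat set \<Rightarrow> (nat \<times> nat \<Rightarrow> nat \<times> nat) monoid" where
  "sub_symmetry_group m n c Q = perm_monoid {\<pi> \<in> index_perms m n.
     \<forall>X\<in>Q. permute_entries \<pi> X \<in> Q \<and> linear_form c (permute_entries \<pi> X) = linear_form c X}"

definition sub_symmetric_group ::
  "nat \<Rightarrow> nat \<Rightarrow> nat set \<Rightarrow> nat set \<Rightarrow> (nat \<times> nat \<Rightarrow> nat \<times> nat) monoid" where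
  "sub_symmetric_group m n R C = perm_monoid {\<pi> \<in> index_perms m n.
     \<exists>\<tau>. \<tau> permutes C \<and> \<pi> = (\<lambda>(i, j). if i \<in> R \<and> j \<in> C then (i, \<tau> j) else (i, j))}"

text \<open>
  The subsets \<open>Q\<^sub>1, \<dots>, Q\<^sub>s\<close> are given by a function \<open>Q\<close> on \<open>{1..s}\<close>.
\<close>

definition symmetries_at ::
  "nat \<Rightarrow> nat \<Rightarrow> real mat \<Rightarrow> nat \<Rightarrow> (nat \<Rightarrow> int mat set) \<Rightarrow> int mat \<Rightarrow>
    (nat \<times> nat \<Rightarrow> nat \<times> nat) set" where
  "symmetries_at m n c s Q X =
     (\<Union>i\<in>{i \<in> {1..s}. X \<in> Q i}. carrier (sub_symmetry_group m n c (Q i)))"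

text \<open>
  \<open>fold permute_entries \<pi>s X\<close> applies the head of \<open>\<pi>s\<close> first. The empty list is allowed, so that the
  relation is reflexive also at matrices lying in none of the \<open>Q i\<close>.
\<close>

definition gen_orbit_rel ::
  "nat \<Rightarrow> nat \<Rightarrow> real mat \<Rightarrow> int mat set \<Rightarrow> nat \<Rightarrow> (nat \<Rightarrow> int mat set) \<Rightarrow> int mat rel" where
  "gen_orbit_rel m n c \<X> s Q = {(X', X). X' \<in> \<X> \<and> X \<in> \<X> \<and>
     (\<exists>\<pi>s. (\<forall>k<length \<pi>s. \<pi>s ! k \<in> symmetries_at m n c s Q (fold permute_entries (take k \<pi>s) X)) \<and>
           X' = fold permute_entries \<pi>s X)}"

definition generalized_orbits ::
  "nat \<Rightarrow> nat \<Rightarrow> real mat \<Rightarrow> int mat set \<Rightarrow> nat \<Rightarrow> (nat \<Rightarrow> int mat set) \<Rightarrow> int mat set set" where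
  "generalized_orbits m n c \<X> s Q = \<X> // gen_orbit_rel m n c \<X> s Q"

text \<open>
  The orbits form a family: an orbit carries the index \<open>i\<close> of the group it comes from, so that the
  same set of matrices, arising as an orbit for two different indices, may be given two
  representatives.
\<close>

definition orbit_family ::
  "nat \<Rightarrow> nat \<Rightarrow> real mat \<Rightarrow> nat \<Rightarrow> (nat \<Rightarrow> int mat set) \<Rightarrow> (nat \<times> int mat set) set" where
  "orbit_family m n c s Q =
     (SIGMA i:{1..s}. orbits (sub_symmetry_group m n c (Q i)) (Q i) permute_entries)"

definition orbit_compatible ::
  "nat \<Rightarrow> nat \<Rightarrow> real mat \<Rightarrow> int mat set \<Rightarrow> nat \<Rightarrow> (nat \<Rightarrow> int mat set) \<Rightarrow>
    (nat \<times> int mat set \<Rightarrow> int mat) \<Rightarrow> bool" where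
  "orbit_compatible m n c \<X> s Q r \<longleftrightarrow>
     (\<forall>(i, \<sigma>)\<in>orbit_family m n c s Q. r (i, \<sigma>) \<in> \<sigma>) \<and>
     (\<forall>\<Omega>\<in>generalized_orbits m n c \<X> s Q.
        let J = {(i, \<sigma>) \<in> orbit_family m n c s Q. \<sigma> \<subseteq> \<Omega>}
        in J \<noteq> {} \<and> \<Omega> = (\<Union>(i, \<sigma>)\<in>J. \<sigma>) \<longrightarrow>
           (\<exists>a\<in>J. \<forall>(i, \<sigma>)\<in>J. r a \<in> \<sigma> \<longrightarrow> r a = r (i, \<sigma>)))"

definition lex_greater :: "int vec \<Rightarrow> int vec \<Rightarrow> bool" (infix \<open>\<succ>\<close> 50) where
  "y \<succ> z \<longleftrightarrow> dim_vec y = dim_vec z \<and>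
     (\<exists>i<dim_vec y. (\<forall>k<i. y $ k = z $ k) \<and> y $ i = 1 \<and> z $ i = 0)"

definition lex_nonincreasing_cols :: "int mat \<Rightarrow> bool" where
  "lex_nonincreasing_cols A \<longleftrightarrow>
     (\<forall>j. Suc j < dim_col A \<longrightarrow> col A j = col A (Suc j) \<or> col A j \<succ> col A (Suc j))"

definition lex_representative :: "nat set \<Rightarrow> nat set \<Rightarrow> int mat set \<Rightarrow> int mat" where
  "lex_representative R C \<sigma> = (THE X. X \<in> \<sigma> \<and> lex_nonincreasing_cols (submatrix X R C))"

end

theory Submission
  imports Defs
begin

text \<open>
  A single integer-valued potential decides which representative to choose. Give the entry in row
  \<open>i\<close> and column \<open>j\<close> the weight \<open>(n - j) 2\<^sup>m\<^sup>-\<^sup>i\<close>. The factors \<open>2\<^sup>m\<^sup>-\<^sup>i\<close> turn the part of a 0/1 column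
  lying in the rows \<open>R\<close> into a number, its key, so that the lexicographic order of columns becomes the
  order of keys (\<open>lex_nonincreasing_cols_iff_column_key\<close>). The factors \<open>n - j\<close> strictly decrease from
  left to right, so, as in the rearrangement inequality, exchanging two columns of \<open>X(R, C)\<close> whose
  keys are in the wrong order strictly increases the potential (\<open>potential_swap_columns\<close>).

  The potential does not depend on \<open>R\<close> and \<open>C\<close>, and this is the whole point. Let \<open>M\<close> be a matrix of
  maximal potential in a generalized orbit that is a union of orbits. If \<open>M\<close> lies in one of these
  orbits, it is maximal there, and the exchanges of two columns do not leave the orbit; hence the
  columns of \<open>M(R\<^sub>i, C\<^sub>i)\<close> are lexicographically non-increasing. An orbit contains only one such matrix,
  since a finite sequence has only one non-increasing rearrangement
  (\<open>antimono_rearrangement_unique\<close>) and a key determines its column. So \<open>M\<close> is the representative of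
  every orbit containing it, whichever of the groups that orbit comes from
  (\<open>lex_representative_eqI\<close>).
\<close>

section \<open>Columns as binary numbers\<close>

text \<open>
  The exponent depends on the row index in the full matrix, not on its rank within \<open>R\<close>: the keys for
  different \<open>R\<close> are then partial sums of the same weighted column and fit one potential.
\<close>

definition column_key :: "nat set \<Rightarrow> int mat \<Rightarrow> nat \<Rightarrow> int" where
  "column_key R X j = (\<Sum>i\<in>R. 2 ^ (dim_row X - i) * X $$ (i, j))"

lemma sum_power2_tail_less:
  "(\<Sum>i\<in>{a<..<m}. 2 ^ (m - i) :: int) < 2 ^ (m - a)"
proof (induction "m - a" arbitrary: a)
  case 0
  then show ?case by simp
next
  case (Suc d)
  show ?case
  proof (cases "Suc a < m")
    case True
    then have "{a<..<m} = insert (Suc a) {Suc a<..<m}" by auto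
    then have "(\<Sum>i\<in>{a<..<m}. 2 ^ (m - i) :: int) =
        2 ^ (m - Suc a) + (\<Sum>i\<in>{Suc a<..<m}. 2 ^ (m - i))" by simp
    also have "\<dots> < 2 ^ (m - Suc a) + 2 ^ (m - Suc a)"
      using Suc.hyps(1)[of "Suc a"] Suc.hyps(2) by simp
    also have "\<dots> = 2 ^ (m - a)"
      using True by (simp add: Suc_diff_Suc flip: power_Suc mult_2)
    finally show ?thesis .
  next
    case False
    then have "{a<..<m} = {}" by auto
    then show ?thesis by simp
  qed
qed

text \<open>
  At the first row where two 0/1 columns differ, the gain \<open>2\<^sup>m\<^sup>-\<^sup>a\<close> outweighs everything that the
  remaining rows can contribute. Gaps in the set of rows only make that remainder smaller.
\<close>

lemma binary_expansion_less:
  fixes f g :: "nat \<Rightarrow> int"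
  assumes A: "A \<subseteq> {..<m}" and a: "a \<in> A" "f a = 1" "g a = 0"
    and f: "\<And>i. i \<in> A \<Longrightarrow> 0 \<le> f i" and g: "\<And>i. i \<in> A \<Longrightarrow> g i \<le> 1"
    and eq: "\<And>i. i \<in> A \<Longrightarrow> i < a \<Longrightarrow> f i = g i"
  shows "(\<Sum>i\<in>A. 2 ^ (m - i) * g i) < (\<Sum>i\<in>A. 2 ^ (m - i) * f i)"
proof -
  define T where "T = A \<inter> {a<..<m}"
  define B where "B = {i \<in> A. i < a}"
  have fin: "finite A" using A finite_subset by blast
  have A_eq: "A = insert a (B \<union> T)" and disj: "a \<notin> B \<union> T" "B \<inter> T = {}"
    using A a by (auto simp: T_def B_def)
  have finBT: "finite B" "finite T" using fin by (auto simp: T_def B_def)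
  have split: "sum h A = h a + (sum h B + sum h T)" for h :: "nat \<Rightarrow> int"
    using A_eq disj finBT by (metis finite_Un sum.insert sum.union_disjoint)
  have "(\<Sum>i\<in>T. 2 ^ (m - i) * g i) \<le> (\<Sum>i\<in>T. 2 ^ (m - i))"
    by (rule sum_mono) (use g in \<open>auto simp: T_def\<close>)
  also have "\<dots> \<le> (\<Sum>i\<in>{a<..<m}. 2 ^ (m - i))"
    by (rule sum_mono2) (auto simp: T_def)
  also have "\<dots> < 2 ^ (m - a)" by (rule sum_power2_tail_less)
  finally have "(\<Sum>i\<in>T. 2 ^ (m - i) * g i) < 2 ^ (m - a)" .
  moreover have "0 \<le> (\<Sum>i\<in>T. 2 ^ (m - i) * f i)"
    by (rule sum_nonneg) (use f in \<open>auto simp: T_def\<close>)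
  moreover have "(\<Sum>i\<in>B. 2 ^ (m - i) * g i) = (\<Sum>i\<in>B. 2 ^ (m - i) * f i)"
    by (rule sum.cong) (auto simp: B_def eq)
  ultimately show ?thesis
    unfolding split using a by simp
qed

lemma binary_mats_entry:
  assumes "X \<in> binary_mats m n" "i < m" "j < n"
  shows "X $$ (i, j) = 0 \<or> X $$ (i, j) = 1"
proof -
  have "X $$ (i, j) \<in> elements_mat X"
    using assms by (intro elements_matI[of X m n]) (auto simp: binary_mats_def)
  then show ?thesis using assms(1) by (auto simp: binary_mats_def)
qed

lemma finite_binary_mats: "finite (binary_mats m n)"
proof (rule finite_subset)
  let ?F = "\<lambda>S. mat m n (\<lambda>p. if p \<in> S then 1 else 0 :: int)"
  show "finite (?F ` Pow ({..<m} \<times> {..<n}))" by simp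
  show "binary_mats m n \<subseteq> ?F ` Pow ({..<m} \<times> {..<n})"
  proof
    fix X assume X: "X \<in> binary_mats m n"
    have "X = ?F {p \<in> {..<m} \<times> {..<n}. X $$ p = 1}"
      using X binary_mats_entry[OF X]
      by (intro eq_matI) (auto simp: binary_mats_def)
    then show "X \<in> ?F ` Pow ({..<m} \<times> {..<n})" by blast
  qed
qed

lemma column_key_eq_imp_entries_eq:
  assumes X: "X \<in> binary_mats m n" and Y: "Y \<in> binary_mats m n" and R: "R \<subseteq> {..<m}"
    and j: "j < n" "k < n" and key: "column_key R X j = column_key R Y k" and i: "i \<in> R"
  shows "X $$ (i, j) = Y $$ (i, k)"
proof (rule ccontr)
  assume "X $$ (i, j) \<noteq> Y $$ (i, k)"
  define a where "a = (LEAST i. i \<in> R \<and> X $$ (i, j) \<noteq> Y $$ (i, k))"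
  have a: "a \<in> R" "X $$ (a, j) \<noteq> Y $$ (a, k)"
    using LeastI[of "\<lambda>i. i \<in> R \<and> X $$ (i, j) \<noteq> Y $$ (i, k)" i]
      \<open>X $$ (i, j) \<noteq> Y $$ (i, k)\<close> i unfolding a_def by auto
  have below: "X $$ (i, j) = Y $$ (i, k)" if "i \<in> R" "i < a" for i
    using not_less_Least[of i "\<lambda>i. i \<in> R \<and> X $$ (i, j) \<noteq> Y $$ (i, k)"] that
    unfolding a_def by auto
  have bX: "X $$ (i, j) = 0 \<or> X $$ (i, j) = 1" and bY: "Y $$ (i, k) = 0 \<or> Y $$ (i, k) = 1"
    if "i \<in> R" for i
    using that R j binary_mats_entry[OF X] binary_mats_entry[OF Y] by blast+
  have dims: "dim_row X = m" "dim_row Y = m" using X Y by (auto simp: binary_mats_def)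
  have bounds: "0 \<le> X $$ (i, j)" "X $$ (i, j) \<le> 1" "0 \<le> Y $$ (i, k)" "Y $$ (i, k) \<le> 1"
    if "i \<in> R" for i
    using bX[OF that] bY[OF that] by auto
  consider "X $$ (a, j) = 1" "Y $$ (a, k) = 0" | "X $$ (a, j) = 0" "Y $$ (a, k) = 1"
    using a bX[OF a(1)] bY[OF a(1)] by auto
  then show False
  proof cases
    case 1
    then show False
      using binary_expansion_less[OF R a(1), of "\<lambda>i. X $$ (i, j)" "\<lambda>i. Y $$ (i, k)"]
        bounds below key unfolding column_key_def dims by force
  next
    case 2
    then show False
      using binary_expansion_less[OF R a(1), of "\<lambda>i. Y $$ (i, k)" "\<lambda>i. X $$ (i, j)"]
        bounds below key unfolding column_key_def dims by force
  qed
qed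

lemma lex_greater_trichotomy:
  assumes "dim_vec y = dim_vec z"
    and "\<And>i. i < dim_vec y \<Longrightarrow> y $ i = 0 \<or> y $ i = 1"
    and "\<And>i. i < dim_vec z \<Longrightarrow> z $ i = 0 \<or> z $ i = 1"
  shows "y = z \<or> y \<succ> z \<or> z \<succ> y"
proof (rule disjCI)
  assume not_greater: "\<not> (y \<succ> z \<or> z \<succ> y)"
  show "y = z"
  proof (rule ccontr)
    assume "y \<noteq> z"
    then obtain l where "l < dim_vec y" "y $ l \<noteq> z $ l"
      using assms(1) by (metis eq_vecI)
    then obtain l where l: "l < dim_vec y" "y $ l \<noteq> z $ l"
      and least: "\<And>k. k < l \<Longrightarrow> y $ k = z $ k"
      using exists_least_iff[of "\<lambda>l. l < dim_vec y \<and> y $ l \<noteq> z $ l"]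
      by (metis less_trans)
    then have "(y $ l = 1 \<and> z $ l = 0) \<or> (y $ l = 0 \<and> z $ l = 1)"
      using assms by metis
    with l least have "y \<succ> z \<or> z \<succ> y"
      unfolding lex_greater_def using assms(1) by metis
    with not_greater show False by blast
  qed
qed

lemma
  assumes X: "X \<in> carrier_mat m n" and RC: "R \<subseteq> {..<m}" "C \<subseteq> {..<n}"
  shows dim_row_submatrix_within: "dim_row (submatrix X R C) = card R"
    and dim_col_submatrix_within: "dim_col (submatrix X R C) = card C"
    and submatrix_entry_within: "k < card R \<Longrightarrow> l < card C \<Longrightarrow>
      submatrix X R C $$ (k, l) = X $$ (pick R k, pick C l)"
proof -
  have "{i. i < dim_row X \<and> i \<in> R} = R" "{j. j < dim_col X \<and> j \<in> C} = C"
    using X RC by auto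
  then show "dim_row (submatrix X R C) = card R" "dim_col (submatrix X R C) = card C"
    "k < card R \<Longrightarrow> l < card C \<Longrightarrow> submatrix X R C $$ (k, l) = X $$ (pick R k, pick C l)"
    by (simp_all add: dim_submatrix submatrix_index)
qed

lemma pick_surj:
  assumes "finite S" "a \<in> S"
  obtains k where "k < card S" "pick S k = a"
proof
  have "{b \<in> S. b < a} \<subset> S" using assms(2) by auto
  then show "card {b \<in> S. b < a} < card S" using assms(1) by (rule psubset_card_mono[rotated])
  show "pick S (card {b \<in> S. b < a}) = a" by (rule pick_card_in_set[OF assms(2)])
qed

lemma lex_greater_imp_column_key_less:
  assumes X: "X \<in> binary_mats m n" and RC: "R \<subseteq> {..<m}" "C \<subseteq> {..<n}"
    and kl: "k < card C" "l < card C"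
    and gt: "col (submatrix X R C) k \<succ> col (submatrix X R C) l"
  shows "column_key R X (pick C l) < column_key R X (pick C k)"
proof -
  have Xc: "X \<in> carrier_mat m n" using X by (simp add: binary_mats_def)
  note sub = dim_row_submatrix_within[OF Xc RC] dim_col_submatrix_within[OF Xc RC]
    submatrix_entry_within[OF Xc RC]
  have entry: "col (submatrix X R C) l' $ q = X $$ (pick R q, pick C l')"
    if "q < card R" "l' < card C" for q l'
    using that by (simp add: col_def sub)
  have len: "dim_vec (col (submatrix X R C) k) = card R" by (simp add: sub)
  obtain q where q: "q < card R"
      "\<forall>p<q. col (submatrix X R C) k $ p = col (submatrix X R C) l $ p"
      "col (submatrix X R C) k $ q = 1" "col (submatrix X R C) l $ q = 0"
    using gt unfolding lex_greater_def len by blast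
  have finR: "finite R" using RC finite_subset by blast
  have cols: "pick C k < n" "pick C l < n"
    using pick_in_set_le[OF kl(1)] pick_in_set_le[OF kl(2)] RC by auto
  have bin: "X $$ (i, j) = 0 \<or> X $$ (i, j) = 1" if "i \<in> R" "j < n" for i j
    using that RC binary_mats_entry[OF X] by blast
  have below: "X $$ (i, pick C k) = X $$ (i, pick C l)" if i: "i \<in> R" "i < pick R q" for i
  proof -
    obtain p where p: "p < card R" "pick R p = i" using pick_surj[OF finR i(1)] .
    have "p < q"
      using i(2) p q(1) pick_mono_le[of p R q] by (metis linorder_neqE_nat order_less_asym)
    then show ?thesis using q(2) entry p kl by auto
  qed
  have "(\<Sum>i\<in>R. 2 ^ (m - i) * X $$ (i, pick C l)) < (\<Sum>i\<in>R. 2 ^ (m - i) * X $$ (i, pick C k))"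
  proof (rule binary_expansion_less[OF RC(1) pick_in_set_le[OF q(1)]])
    show "X $$ (pick R q, pick C k) = 1" "X $$ (pick R q, pick C l) = 0"
      using q entry kl by auto
    show "0 \<le> X $$ (i, pick C k)" "X $$ (i, pick C l) \<le> 1" if "i \<in> R" for i
      using bin[OF that cols(1)] bin[OF that cols(2)] by auto
  qed (use below in auto)
  then show ?thesis using Xc by (simp add: column_key_def)
qed

text \<open>
  The definition on the left compares adjacent columns of the sub-matrix, numbered by rank in \<open>C\<close>;
  the right-hand side compares arbitrary columns numbered as in \<open>X\<close>. Since the columns are 0/1
  vectors, the lexicographic comparison is total, so it is reflected as well as preserved by keys.
\<close>

lemma lex_nonincreasing_cols_iff_column_key:
  assumes X: "X \<in> binary_mats m n" and RC: "R \<subseteq> {..<m}" "C \<subseteq> {..<n}"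
  shows "lex_nonincreasing_cols (submatrix X R C) \<longleftrightarrow>
    antimono_on C (column_key R X)"
proof -
  have Xc: "X \<in> carrier_mat m n" using X by (simp add: binary_mats_def)
  note sub = dim_row_submatrix_within[OF Xc RC] dim_col_submatrix_within[OF Xc RC]
    submatrix_entry_within[OF Xc RC]
  have finC: "finite C" using RC finite_subset by blast
  let ?col = "col (submatrix X R C)" and ?key = "\<lambda>l. column_key R X (pick C l)"
  have bin: "?col l $ q = 0 \<or> ?col l $ q = 1" if "q < card R" "l < card C" for q l
    using that pick_in_set_le[of q R] pick_in_set_le[of l C] RC binary_mats_entry[OF X]
    by (auto simp: col_def sub subset_iff)
  have eq: "?key k = ?key l" if "k < card C" "l < card C" "?col k = ?col l" for k l
  proof -
    have "X $$ (i, pick C k) = X $$ (i, pick C l)" if i: "i \<in> R" for i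
    proof -
      have "finite R" using RC finite_subset by blast
      then obtain p where p: "p < card R" "pick R p = i" using pick_surj i by blast
      then show ?thesis
        using arg_cong[OF \<open>?col k = ?col l\<close>, of "\<lambda>v. v $ p"] that(1) \<open>k < card C\<close> \<open>l < card C\<close>
        by (simp add: col_def sub)
    qed
    then show ?thesis by (simp add: column_key_def)
  qed
  have step: "?col k = ?col l \<or> ?col k \<succ> ?col l \<longleftrightarrow> ?key l \<le> ?key k"
    if kl: "k < card C" "l < card C" for k l
  proof -
    have "?col k = ?col l \<or> ?col k \<succ> ?col l \<or> ?col l \<succ> ?col k"
      using kl bin by (intro lex_greater_trichotomy) (auto simp: sub)
    then show ?thesis
      using eq[OF kl] lex_greater_imp_column_key_less[OF X RC kl]
        lex_greater_imp_column_key_less[OF X RC kl(2) kl(1)] by force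
  qed
  have "lex_nonincreasing_cols (submatrix X R C) \<longleftrightarrow>
      (\<forall>l. Suc l < card C \<longrightarrow> ?key (Suc l) \<le> ?key l)"
    unfolding lex_nonincreasing_cols_def sub using step by auto
  also have "\<dots> \<longleftrightarrow> antimono_on C (column_key R X)"
  proof
    assume adj: "\<forall>l. Suc l < card C \<longrightarrow> ?key (Suc l) \<le> ?key l"
    have chain: "l < card C \<Longrightarrow> ?key l \<le> ?key k" if "k \<le> l" for k l
      using that by (induction rule: dec_induct) (use adj in \<open>auto intro: order_trans\<close>)
    show "antimono_on C (column_key R X)"
    proof (rule monotone_onI)
      fix a b assume ab: "a \<in> C" "b \<in> C" "a \<le> b"
      obtain k where k: "k < card C" "pick C k = a" using pick_surj[OF finC ab(1)] .
      obtain l where l: "l < card C" "pick C l = b" using pick_surj[OF finC ab(2)] .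
      have "k \<le> l"
        using ab(3) k l pick_mono_le[of k C l] by (metis leD leI)
      then show "column_key R X b \<le> column_key R X a" using chain k l by blast
    qed
  next
    assume "antimono_on C (column_key R X)"
    then show "\<forall>l. Suc l < card C \<longrightarrow> ?key (Suc l) \<le> ?key l"
      using pick_in_set_le[of _ C] pick_mono_le[of _ C]
      by (auto simp: monotone_on_def less_imp_le simp del: pick.simps)
  qed
  finally show ?thesis .
qed

section \<open>Uniqueness of the sorted rearrangement\<close>

text \<open>
  For every threshold \<open>v\<close>, the positions with value at least \<open>v\<close> form an initial segment of \<open>C\<close>, both
  before and after the rearrangement. The two segments have the same size, so they coincide; all
  level sets being equal, so are the functions.
\<close>

lemma antimono_rearrangement_unique:
  fixes f :: "nat \<Rightarrow> 'b::linorder"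
  assumes "finite C" "\<tau> permutes C" and f: "antimono_on C f" and g: "antimono_on C (f \<circ> \<tau>)"
    and "j \<in> C"
  shows "f (\<tau> j) = f j"
proof -
  have level: "{k \<in> C. v \<le> f (\<tau> k)} = {k \<in> C. v \<le> f k}" for v
  proof -
    let ?A = "{k \<in> C. v \<le> f (\<tau> k)}" and ?B = "{k \<in> C. v \<le> f k}"
    have "\<tau> ` ?A = ?B"
    proof
      show "\<tau> ` ?A \<subseteq> ?B" using assms(2) by (auto simp: permutes_in_image)
      show "?B \<subseteq> \<tau> ` ?A"
      proof
        fix b assume b: "b \<in> ?B"
        then obtain a where "a \<in> C" "b = \<tau> a"
          using permutes_image[OF assms(2)] by blast
        with b show "b \<in> \<tau> ` ?A" by auto
      qed
    qed
    then have card: "card ?A = card ?B"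
      using card_image[of \<tau> ?A] permutes_inj_on[OF assms(2), of ?A] by simp
    have "?A \<subseteq> ?B \<or> ?B \<subseteq> ?A"
    proof (rule ccontr)
      assume "\<not> ?thesis"
      then obtain a b where a: "a \<in> C" "v \<le> f (\<tau> a)" "\<not> v \<le> f a"
        and b: "b \<in> C" "v \<le> f b" "\<not> v \<le> f (\<tau> b)" by auto
      show False
      proof (cases "a \<le> b")
        case True
        then show False using f a b unfolding monotone_on_def by (meson order_trans)
      next
        case False
        then have "b \<le> a" by simp
        then show False using g a b unfolding monotone_on_def comp_def by (meson order_trans)
      qed
    qed
    moreover have "finite ?A" "finite ?B" using assms(1) by auto
    ultimately show ?thesis using card card_subset_eq[of ?A ?B] card_subset_eq[of ?B ?A] by auto
  qed
  have "f j \<le> f (\<tau> j)" using level[of "f j"] assms(5) by blast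
  moreover have "f (\<tau> j) \<le> f j" using level[of "f (\<tau> j)"] assms(5) by blast
  ultimately show ?thesis by simp
qed

section \<open>Rearranging columns of a sub-matrix\<close>

text \<open>
  The permutation says from where the new entry is taken. This is inverse to the direction of
  \<open>permute_entries\<close>, so consecutive rearrangements compose in the opposite order.
\<close>

definition shuffle_columns ::
  "nat set \<Rightarrow> nat set \<Rightarrow> (nat \<Rightarrow> nat) \<Rightarrow> int mat \<Rightarrow> int mat" where
  "shuffle_columns R C \<tau> X = mat (dim_row X) (dim_col X)
     (\<lambda>(i, j). if i \<in> R \<and> j \<in> C then X $$ (i, \<tau> j) else X $$ (i, j))"

lemma dim_shuffle_columns [simp]:
  "dim_row (shuffle_columns R C \<tau> X) = dim_row X" "dim_col (shuffle_columns R C \<tau> X) = dim_col X"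
  by (simp_all add: shuffle_columns_def)

lemma shuffle_columns_entry:
  assumes "i < dim_row X" "j < dim_col X"
  shows "shuffle_columns R C \<tau> X $$ (i, j) =
    (if i \<in> R \<and> j \<in> C then X $$ (i, \<tau> j) else X $$ (i, j))"
  using assms by (simp add: shuffle_columns_def)

lemma shuffle_columns_id: "shuffle_columns R C id X = X"
  by (rule eq_matI) (auto simp: shuffle_columns_entry)

lemma shuffle_columns_comp:
  assumes "\<tau> permutes C" "C \<subseteq> {..<dim_col X}"
  shows "shuffle_columns R C \<tau> (shuffle_columns R C \<tau>' X) = shuffle_columns R C (\<tau>' \<circ> \<tau>) X"
  using assms permutes_in_image[OF assms(1)]
  by (intro eq_matI) (auto simp: shuffle_columns_entry subset_iff)

lemma shuffle_columns_binary:
  assumes X: "X \<in> binary_mats m n" and "\<tau> permutes C" "C \<subseteq> {..<n}"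
  shows "shuffle_columns R C \<tau> X \<in> binary_mats m n"
proof -
  have dims: "dim_row X = m" "dim_col X = n" using X by (auto simp: binary_mats_def)
  have "shuffle_columns R C \<tau> X $$ (i, j) \<in> {0, 1}" if "i < m" "j < n" for i j
    using that assms permutes_in_image[OF assms(2), of j] binary_mats_entry[OF X]
    by (auto simp: shuffle_columns_entry dims subset_iff)
  then have "elements_mat (shuffle_columns R C \<tau> X) \<subseteq> {0, 1}"
    using elements_matD[of _ "shuffle_columns R C \<tau> X"] by (simp add: dims subset_iff) metis
  moreover have "shuffle_columns R C \<tau> X \<in> carrier_mat m n"
    by (rule carrier_matI) (simp_all add: dims)
  ultimately show ?thesis
    unfolding binary_mats_def by blast
qed

lemma column_key_shuffle_columns:
  assumes "R \<subseteq> {..<dim_row X}" "C \<subseteq> {..<dim_col X}" "j \<in> C"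
  shows "column_key R (shuffle_columns R C \<tau> X) j = column_key R X (\<tau> j)"
  unfolding column_key_def
  by (rule sum.cong) (use assms in \<open>auto simp: shuffle_columns_entry subset_iff\<close>)

lemma column_key_shuffle_columns_all_rows:
  assumes R: "R \<subseteq> {..<dim_row X}" and j: "j < dim_col X"
  shows "column_key {..<dim_row X} (shuffle_columns R C \<tau> X) j - column_key {..<dim_row X} X j =
    (if j \<in> C then column_key R X (\<tau> j) - column_key R X j else 0)"
proof -
  let ?Y = "shuffle_columns R C \<tau> X"
  have "column_key {..<dim_row X} ?Y j - column_key {..<dim_row X} X j =
      (\<Sum>i<dim_row X. 2 ^ (dim_row X - i) * (?Y $$ (i, j) - X $$ (i, j)))"
    by (simp add: column_key_def sum_subtractf right_diff_distrib)
  also have "\<dots> = (\<Sum>i\<in>R. 2 ^ (dim_row X - i) * (?Y $$ (i, j) - X $$ (i, j)))"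
    by (rule sum.mono_neutral_right) (use R j in \<open>auto simp: shuffle_columns_entry\<close>)
  also have "\<dots> = (\<Sum>i\<in>R. 2 ^ (dim_row X - i) * (if j \<in> C then X $$ (i, \<tau> j) - X $$ (i, j) else 0))"
    by (rule sum.cong) (use R j in \<open>auto simp: shuffle_columns_entry subset_iff\<close>)
  also have "\<dots> = (if j \<in> C then column_key R X (\<tau> j) - column_key R X j else 0)"
    by (simp add: column_key_def sum_subtractf right_diff_distrib)
  finally show ?thesis .
qed

text \<open>
  The column numbers start at 0, so the weight \<open>n - j\<close> runs from \<open>n\<close> down to 1.
\<close>

definition potential :: "int mat \<Rightarrow> int" where
  "potential X = (\<Sum>j<dim_col X. int (dim_col X - j) * column_key {..<dim_row X} X j)"

text \<open>
  Only the columns \<open>a\<close> and \<open>b\<close> change, and only in the rows \<open>R\<close>: the value that one gains,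
  the other loses. The gain and the loss enter with the factors \<open>n - a\<close> and \<open>n - b\<close>,
  which differ by \<open>b - a\<close>.
\<close>

lemma potential_swap_columns:
  assumes R: "R \<subseteq> {..<dim_row X}" and C: "C \<subseteq> {..<dim_col X}" and ab: "a \<in> C" "b \<in> C" "a < b"
  shows "potential (shuffle_columns R C (transpose a b) X) - potential X =
    int (b - a) * (column_key R X b - column_key R X a)"
proof -
  let ?Y = "shuffle_columns R C (transpose a b) X" and ?n = "dim_col X"
  let ?D = "\<lambda>j. if j \<in> C then column_key R X (transpose a b j) - column_key R X j else 0"
  have "potential ?Y - potential X = (\<Sum>j<?n. int (?n - j) *
      (column_key {..<dim_row X} ?Y j - column_key {..<dim_row X} X j))"
    by (simp add: potential_def sum_subtractf right_diff_distrib)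
  also have "\<dots> = (\<Sum>j<?n. int (?n - j) * ?D j)"
    by (rule sum.cong) (use column_key_shuffle_columns_all_rows[OF R] in auto)
  also have "\<dots> = (\<Sum>j\<in>{a, b}. int (?n - j) * ?D j)"
    by (rule sum.mono_neutral_right) (use ab C in \<open>auto simp: transpose_def\<close>)
  also have "\<dots> = (int (?n - a) - int (?n - b)) * (column_key R X b - column_key R X a)"
    using ab by (simp add: algebra_simps)
  also have "int (?n - a) - int (?n - b) = int (b - a)"
    using ab C by (auto simp: subset_iff of_nat_diff)
  finally show ?thesis .
qed

section \<open>Representatives maximize the potential\<close>

lemma orbit_sub_symmetric_group:
  assumes X: "X \<in> carrier_mat m n" and RC: "R \<subseteq> {..<m}" "C \<subseteq> {..<n}"
  shows "orbit (sub_symmetric_group m n R C) permute_entries X =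
    {shuffle_columns R C \<tau> X | \<tau>. \<tau> permutes C}"
proof -
  define P where "P \<tau> = (\<lambda>(i, j). if i \<in> R \<and> j \<in> C then (i, \<tau> j) else (i, j))"
    for \<tau> :: "nat \<Rightarrow> nat"
  have comp_inv: "P \<tau> (P (inv_into UNIV \<tau>) p) = p" "P (inv_into UNIV \<tau>) (P \<tau> p) = p" if "\<tau> permutes C" for \<tau> p
    using that permutes_in_image[OF that] permutes_in_image[OF permutes_inv[OF that]]
    by (auto simp: P_def permutes_inverses split: prod.splits if_splits)
  have inv: "inv_into UNIV (P \<tau>) = P (inv_into UNIV \<tau>)" if "\<tau> permutes C" for \<tau>
    using comp_inv[OF that] by (intro inv_equality) auto
  have perm: "P \<tau> \<in> index_perms m n" if "\<tau> permutes C" for \<tau>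
  proof -
    have "P \<tau> p = p" if "p \<notin> {..<m} \<times> {..<n}" for p
      using that RC by (auto simp: P_def split: prod.splits)
    moreover have "\<exists>!p. P \<tau> p = q" for q
      using comp_inv[OF that] by metis
    ultimately show ?thesis
      unfolding index_perms_def permutes_def by blast
  qed
  have action: "permute_entries (P \<tau>) X = shuffle_columns R C (inv_into UNIV \<tau>) X"
    if "\<tau> permutes C" for \<tau>
    unfolding permute_entries_def inv[OF that]
    by (rule eq_matI) (auto simp: shuffle_columns_entry P_def)
  \<comment> \<open>Each \<open>P \<tau>\<close> is itself an index permutation, so membership in \<open>index_perms\<close> cuts nothing off.\<close>
  have "carrier (sub_symmetric_group m n R C) = {P \<tau> | \<tau>. \<tau> permutes C}"
    unfolding sub_symmetric_group_def perm_monoid_def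
    using perm by (auto simp: P_def)
  then have "orbit (sub_symmetric_group m n R C) permute_entries X =
      {permute_entries (P \<tau>) X | \<tau>. \<tau> permutes C}"
    unfolding orbit_def by auto
  also have "\<dots> = {shuffle_columns R C (inv_into UNIV \<tau>) X | \<tau>. \<tau> permutes C}"
    using action by (metis (no_types, lifting))
  also have "\<dots> = {shuffle_columns R C \<tau> X | \<tau>. \<tau> permutes C}"
    by (metis permutes_inv permutes_inv_inv)
  finally show ?thesis .
qed

text \<open>
  The element of maximal potential is sorted because any two columns in the wrong order could be
  exchanged with profit. The definite description in \<open>lex_representative\<close> then denotes it, since any
  other sorted element is a rearrangement with the same keys, hence with the same entries.
\<close>

lemma lex_representative_eqI:
  assumes X: "X \<in> binary_mats m n" and RC: "R \<subseteq> {..<m}" "C \<subseteq> {..<n}"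
    and \<sigma>: "\<sigma> = {shuffle_columns R C \<tau> X | \<tau>. \<tau> permutes C}"
    and M: "M \<in> \<sigma>" and max: "\<And>Y. Y \<in> \<sigma> \<Longrightarrow> potential Y \<le> potential M"
  shows "lex_representative R C \<sigma> = M"
proof -
  have finC: "finite C" using RC finite_subset by blast
  have dimX: "dim_row X = m" "dim_col X = n" using X by (auto simp: binary_mats_def)
  obtain \<rho> where \<rho>: "\<rho> permutes C" "M = shuffle_columns R C \<rho> X" using M \<sigma> by blast
  have Mb: "M \<in> binary_mats m n" using shuffle_columns_binary[OF X \<rho>(1) RC(2)] \<rho>(2) by simp
  have dimM: "dim_row M = m" "dim_col M = n" using Mb by (auto simp: binary_mats_def)
  have orbit_M: "shuffle_columns R C \<tau> M \<in> \<sigma>" if "\<tau> permutes C" for \<tau>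
    using that \<rho> RC shuffle_columns_comp[OF that, of X R \<rho>] permutes_compose[OF that \<rho>(1)]
    unfolding \<sigma> dimX by auto
  have sorted: "antimono_on C (column_key R M)"
  proof (rule monotone_onI, rule ccontr)
    fix a b assume ab: "a \<in> C" "b \<in> C" "a \<le> b" "\<not> column_key R M b \<le> column_key R M a"
    then have "a < b" by (cases "a = b") auto
    then have "0 < potential (shuffle_columns R C (transpose a b) M) - potential M"
      using potential_swap_columns[of R M C a b] ab RC by (simp add: dimM)
    then show False
      using max[OF orbit_M[OF permutes_swap_id[OF ab(1,2)]]] by simp
  qed
  have "Y = M" if Y: "Y \<in> \<sigma>" "antimono_on C (column_key R Y)" for Y
  proof -
    obtain \<tau> where \<tau>: "\<tau> permutes C" "Y = shuffle_columns R C \<tau> X" using Y \<sigma> by blast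
    \<comment> \<open>Both matrices are rearrangements of \<open>X\<close>; \<open>\<mu>\<close> leads from \<open>M\<close> directly to \<open>Y\<close>.\<close>
    define \<mu> where "\<mu> = inv_into UNIV \<rho> \<circ> \<tau>"
    have \<mu>: "\<mu> permutes C"
      unfolding \<mu>_def using \<tau>(1) permutes_inv[OF \<rho>(1)] by (rule permutes_compose)
    have "\<rho> \<circ> \<mu> = \<tau>"
      unfolding \<mu>_def using permutes_inverses(1)[OF \<rho>(1)] by auto
    then have Y_eq: "Y = shuffle_columns R C \<mu> M"
      using shuffle_columns_comp[OF \<mu>, of X R \<rho>] RC \<tau>(2) \<rho>(2) by (simp add: dimX)
    have key: "column_key R Y j = column_key R M (\<mu> j)" if "j \<in> C" for j
      using column_key_shuffle_columns[of R M C j \<mu>] that RC by (simp add: Y_eq dimM)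
    then have "antimono_on C (column_key R M \<circ> \<mu>)"
      using Y(2) by (simp add: monotone_on_def)
    note same = antimono_rearrangement_unique[OF finC \<mu> sorted this]
    show "Y = M"
    proof (rule eq_matI)
      fix i j assume "i < dim_row M" "j < dim_col M"
      moreover have "M $$ (i, \<mu> j) = M $$ (i, j)" if "i \<in> R" "j \<in> C"
        using column_key_eq_imp_entries_eq[OF Mb Mb RC(1) _ _ same[OF that(2)] that(1)]
          that permutes_in_image[OF \<mu>, of j] RC by (auto simp: subset_iff)
      ultimately show "Y $$ (i, j) = M $$ (i, j)"
        unfolding Y_eq by (simp add: shuffle_columns_entry)
    qed (simp_all add: Y_eq)
  qed
  moreover have "Y \<in> binary_mats m n" if "Y \<in> \<sigma>" for Y
    using that shuffle_columns_binary[OF X _ RC(2)] \<sigma> by blast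
  ultimately have "Y = M" if "Y \<in> \<sigma>" "lex_nonincreasing_cols (submatrix Y R C)" for Y
    using that lex_nonincreasing_cols_iff_column_key[OF _ RC] by blast
  moreover have "lex_nonincreasing_cols (submatrix M R C)"
    using lex_nonincreasing_cols_iff_column_key[OF Mb RC] sorted by blast
  ultimately show ?thesis
    unfolding lex_representative_def using M by blast
qed

text \<open>
  The orbits in \<open>J\<close> may belong to different row and column sets, but all are ranked by the same
  potential, so one matrix serves them all. With a single orbit in \<open>J\<close> this says that the
  representative exists and belongs to its orbit.
\<close>

lemma lex_representative_eq_global_maximum:
  assumes J: "\<And>i \<sigma>. (i, \<sigma>) \<in> J \<Longrightarrow> R i \<subseteq> {..<m} \<and> C i \<subseteq> {..<n} \<and>
      (\<exists>X\<in>binary_mats m n. \<sigma> = {shuffle_columns (R i) (C i) \<tau> X | \<tau>. \<tau> permutes C i})"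
    and "J \<noteq> {}"
  shows "\<exists>M\<in>(\<Union>(i, \<sigma>)\<in>J. \<sigma>). \<forall>(i, \<sigma>)\<in>J. M \<in> \<sigma> \<longrightarrow> lex_representative (R i) (C i) \<sigma> = M"
proof -
  let ?U = "\<Union>(i, \<sigma>)\<in>J. \<sigma>"
  have "\<sigma> \<subseteq> binary_mats m n" if orb: "(i, \<sigma>) \<in> J" for i \<sigma>
  proof
    fix Y assume "Y \<in> \<sigma>"
    moreover obtain X where "X \<in> binary_mats m n" "C i \<subseteq> {..<n}"
        "\<sigma> = {shuffle_columns (R i) (C i) \<tau> X | \<tau>. \<tau> permutes C i}"
      using J[OF orb] by blast
    ultimately show "Y \<in> binary_mats m n"
      using shuffle_columns_binary by auto
  qed
  then have "?U \<subseteq> binary_mats m n" by blast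
  then have fin: "finite ?U" using finite_binary_mats finite_subset by blast
  obtain i \<sigma> where "(i, \<sigma>) \<in> J" using \<open>J \<noteq> {}\<close> by auto
  moreover from this have "\<sigma> \<noteq> {}" using J permutes_id by blast
  ultimately have ne: "?U \<noteq> {}" by blast
  have "Max (potential ` ?U) \<in> potential ` ?U"
    by (rule Max_in) (use fin ne in \<open>simp_all only: finite_imageI image_is_empty not_False_eq_True\<close>)
  then obtain M where M: "M \<in> ?U" "Max (potential ` ?U) = potential M" by (rule imageE)
  have M_max: "potential Y \<le> potential M" if "Y \<in> ?U" for Y
    unfolding M(2)[symmetric] by (rule Max_ge) (use fin that in \<open>simp_all only: finite_imageI imageI\<close>)
  have "lex_representative (R i) (C i) \<sigma> = M" if i: "(i, \<sigma>) \<in> J" "M \<in> \<sigma>" for i \<sigma>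
  proof -
    from J[OF i(1)] obtain X where X: "X \<in> binary_mats m n"
        "\<sigma> = {shuffle_columns (R i) (C i) \<tau> X | \<tau>. \<tau> permutes C i}"
      by blast
    show ?thesis
      by (rule lex_representative_eqI[OF X(1) _ _ X(2) i(2)]) (use J i M_max in blast)+
  qed
  with M(1) show ?thesis by blast
qed

theorem lemma3:
  fixes m n s :: nat
    and c :: "real mat"
    and K :: "(real mat \<times> real) set"
    and \<X> :: "int mat set"
    and Q :: "nat \<Rightarrow> int mat set"
    and R C :: "nat \<Rightarrow> nat set"
  assumes "c \<in> carrier_mat m n"
    and "finite K" and "\<forall>(a, b)\<in>K. a \<in> carrier_mat m n"
    and "\<X> = ilp_solutions m n K"
    and "\<forall>i\<in>{1..s}. Q i \<subseteq> \<X>"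
    and "\<forall>i\<in>{1..s}. R i \<subseteq> {..<m} \<and> C i \<subseteq> {..<n}"
    and "\<forall>i\<in>{1..s}. sub_symmetry_group m n c (Q i) = sub_symmetric_group m n (R i) (C i)"
  shows "orbit_compatible m n c \<X> s Q (\<lambda>(i, \<sigma>). lex_representative (R i) (C i) \<sigma>)"
proof -
  let ?F = "orbit_family m n c s Q"
  have Q: "Q i \<subseteq> binary_mats m n" if "i \<in> {1..s}" for i
    using that assms(4,5) by (auto simp: ilp_solutions_def)
  have family: "R i \<subseteq> {..<m} \<and> C i \<subseteq> {..<n} \<and>
      (\<exists>X\<in>binary_mats m n. \<sigma> = {shuffle_columns (R i) (C i) \<tau> X | \<tau>. \<tau> permutes C i})"
    if orb: "(i, \<sigma>) \<in> ?F" for i \<sigma>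
  proof -
    have i: "i \<in> {1..s}" using orb by (auto simp: orbit_family_def)
    obtain X where X: "X \<in> Q i"
        "\<sigma> = orbit (sub_symmetry_group m n c (Q i)) permute_entries X"
      using orb by (auto simp: orbit_family_def orbits_def)
    then have Xb: "X \<in> binary_mats m n" using Q[OF i] by blast
    moreover have "X \<in> carrier_mat m n" using Xb by (simp add: binary_mats_def)
    ultimately show ?thesis
      using X(2) assms(6,7) i orbit_sub_symmetric_group[of X m n "R i" "C i"] by auto
  qed
  show ?thesis
    unfolding orbit_compatible_def Let_def
  proof (intro conjI ballI impI)
    fix a assume a: "a \<in> ?F"
    obtain i \<sigma> where a_eq: "a = (i, \<sigma>)" by fastforce
    obtain M where "M \<in> \<sigma>" "lex_representative (R i) (C i) \<sigma> = M"
      using lex_representative_eq_global_maximum[of "{(i, \<sigma>)}" R m C n] family a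
      unfolding a_eq by auto
    then show "case a of (i, \<sigma>) \<Rightarrow> (case (i, \<sigma>) of (i, \<sigma>) \<Rightarrow> lex_representative (R i) (C i) \<sigma>) \<in> \<sigma>"
      by (simp add: a_eq)
  next
    fix \<Omega>
    let ?J = "{(i, \<sigma>) \<in> ?F. \<sigma> \<subseteq> \<Omega>}"
    assume "?J \<noteq> {} \<and> \<Omega> = (\<Union>(i, \<sigma>)\<in>?J. \<sigma>)"
    then have nonempty: "?J \<noteq> {}" ..
    have subfamily: "R i \<subseteq> {..<m} \<and> C i \<subseteq> {..<n} \<and>
        (\<exists>X\<in>binary_mats m n. \<sigma> = {shuffle_columns (R i) (C i) \<tau> X | \<tau>. \<tau> permutes C i})"
      if "(i, \<sigma>) \<in> ?J" for i \<sigma>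
      using that by (intro family) simp
    have "\<exists>M\<in>(\<Union>(i, \<sigma>)\<in>?J. \<sigma>).
        \<forall>(i, \<sigma>)\<in>?J. M \<in> \<sigma> \<longrightarrow> lex_representative (R i) (C i) \<sigma> = M"
      by (rule lex_representative_eq_global_maximum[OF _ nonempty]) (rule subfamily)
    then obtain M where M: "M \<in> (\<Union>(i, \<sigma>)\<in>?J. \<sigma>)"
      "\<forall>(i, \<sigma>)\<in>?J. M \<in> \<sigma> \<longrightarrow> lex_representative (R i) (C i) \<sigma> = M"
      by (rule bexE)
    from M(1) obtain i \<sigma> where "(i, \<sigma>) \<in> ?J" "M \<in> \<sigma>" by blast
    with M(2) show "\<exists>a\<in>?J. \<forall>(i, \<sigma>)\<in>?J.
        (case a of (i, \<sigma>) \<Rightarrow> lex_representative (R i) (C i) \<sigma>) \<in> \<sigma> \<longrightarrow>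
        (case a of (i, \<sigma>) \<Rightarrow> lex_representative (R i) (C i) \<sigma>) =
        (case (i, \<sigma>) of (i, \<sigma>) \<Rightarrow> lex_representative (R i) (C i) \<sigma>)"
      by (intro bexI[of _ "(i, \<sigma>)"]) auto
  qed
qed

end
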